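(* Let $\nu\in\mathcal N_0$ be an interior (coupling) node of the network. (1) For the compressible non-isothermal Euler equations, mass conservation (M) and equality of specific total enthalpy (H) at $\nu$ imply energy conservation at $\nu$, i.e. $$\sum_{\omega\in\mathcal E(\nu)}n^\omega[\nu]\,\bigl(v^\omega(E^\omega+p^\omega)\bigr)\big|_\nu=0 .$$ (2) From (M) and equality of outgoing entropy ($\mathrm S_{out}$) at $\nu$ it follows that entropy per unit volume in smooth flows is conserved at $\nu$, i.e. $$\sum_{\omega\in\mathcal E(\nu)}n^\omega[\nu]\,m^\omega|_\nu\, s^\omega|_\nu=0,\qquad t>0 .$$
   Context: Network: a connected, finite, directed graph with node set $\mathcal N$ and edge (pipe) set $\mathcal E\subset\mathcal N\times\mathcal N$ (without self-loops). $\mathcal N_0\subset\mathcal N$ is the set of interior nodes; $\mathcal E(\nu)$ is the set of edges adjacent to $\nu$, i.e. $\omega=(\nu,\bar\nu)$ or $\omega=(\bar\nu,\nu)$ for some $\bar\nu$. Incidence mapping: $n^\omega[\nu]=1$ if $\omega=(\nu,\bar\nu)$ for some $\bar\nu$, $n^\omega[\nu]=-1$ if $\omega=(\bar\nu,\nu)$ for some $\bar\nu$, and $0$ otherwise. On each pipe $\omega$: mass density $\rho^\omega>0$, velocity $v^\omega$, mass flow $m^\omega=\rho^\omega v^\omega$, pressure $p^\omega$, total energy $E^\omega=\rho^\omega(\epsilon^\omega+\frac{(v^\omega)^2}{2})$ with internal energy $\epsilon^\omega=c_vT^\omega$, specific total enthalpy $h^\omega=\frac{E^\omega+p^\omega}{\rho^\omega}$,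 specific entropy $s^\omega=c_v\ln\bigl(p^\omega/(\rho^\omega)^\gamma\bigr)$ (ideal gas, $p^\omega=RT^\omega\rho^\omega$, $\gamma=c_p/c_v$, $c_p=R+c_v$). The notation $|_\nu$ denotes evaluation at the end of the pipe at node $\nu$. Let $\delta_{in}(\nu)=\{\omega\in\mathcal E:\exists\bar\nu,\ \omega=(\bar\nu,\nu)\}$, $\delta_{out}(\nu)=\{\omega\in\mathcal E:\exists\bar\nu,\ \omega=(\nu,\bar\nu)\}$, and $$\mathcal I_{in}(\nu)=\{\omega\in\delta_{in}(\nu):m^\omega\ge0\}\cup\{\omega\in\delta_{out}(\nu):m^\omega\le0\},\quad \mathcal I_{out}(\nu)=\{\omega\in\delta_{in}(\nu):m^\omega<0\}\cup\{\omega\in\delta_{out}(\nu):m^\omega>0\}.$$ Standing assumption: the flow direction never changes, so that $\mathcal I_{in}(\nu)=\delta_{in}(\nu)$ and $\mathcal I_{out}(\nu)=\delta_{out}(\nu)$. Coupling conditions at $\nu$: (M) $\sum_{\omega\in\mathcal E(\nu)}n^\omega[\nu]\,m^\omega|_\nu=0$. (H) there is $h^*$ with $h^\omega|_\nu=h^*$ for all $\omega\in\mathcal E(\nu)$. ($\mathrm S_{out}$) $s^\omega|_\nu=s^*$ for all $\omega\in\mathcal I_{out}(\nu)$, where $$s^*=\frac{1}{\sum_{\omega\in\mathcal I_{in}(\nu)}n^\omega[\nu]m^\omega|_\nu}\sum_{\omega\in\mathcal I_{in}(\nu)}n^\omega[\nu]\,m^\omega|_\nu\, s^\omega|_\nu$$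 (the denominator being nonzero, as is implicit in the definition). *)

theory Defs
  imports "HOL-Analysis.Analysis" "Graph_Theory.Graph_Theory"
begin

text \<open>
  A pipe \<open>\<omega> = (\<mu>, \<nu>)\<close> is parametrised by \<open>x \<in> [0, len \<omega>]\<close>, with \<open>x = 0\<close> at \<open>\<mu>\<close> and
  \<open>x = len \<omega>\<close> at \<open>\<nu>\<close>. Fields take the pipe, the time and the position in this order.
  Density, velocity and temperature are the independent fields; all others are derived.
\<close>

record 'a gas_network =
  dgraph :: "'a pair_pre_digraph"
  interior_nodes :: "'a set"
  len :: "'a \<times> 'a \<Rightarrow> real"
  gas_const :: real
  c_v :: real
  dens :: "'a \<times> 'a \<Rightarrow> real \<Rightarrow> real \<Rightarrow> real"
  vel :: "'a \<times> 'a \<Rightarrow> real \<Rightarrow> real \<Rightarrow> real"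
  temp :: "'a \<times> 'a \<Rightarrow> real \<Rightarrow> real \<Rightarrow> real"

text \<open>
  \<open>Digraph_Component.connected\<close> is connectedness of the underlying undirected graph.
  Absolute temperature is positive: the argument of the logarithm in the entropy is then positive.
\<close>

definition gas_network :: "'a gas_network \<Rightarrow> bool" where
  "gas_network N \<longleftrightarrow>
     pair_digraph (dgraph N) \<and>
     Digraph_Component.connected (with_proj (dgraph N)) \<and>
     interior_nodes N \<subseteq> pverts (dgraph N) \<and>
     gas_const N > 0 \<and> c_v N > 0 \<and>
     (\<forall>\<omega>\<in>parcs (dgraph N). len N \<omega> > 0 \<and>
        (\<forall>t>0. \<forall>x\<in>{0..len N \<omega>}. dens N \<omega> t x > 0 \<and> temp N \<omega> t x > 0))"

definition c_p :: "'a gas_network \<Rightarrow> real" where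
  "c_p N = gas_const N + c_v N"

definition adiabatic_index :: "'a gas_network \<Rightarrow> real" where
  "adiabatic_index N = c_p N / c_v N"

definition mass_flow :: "'a gas_network \<Rightarrow> 'a \<times> 'a \<Rightarrow> real \<Rightarrow> real \<Rightarrow> real" where
  "mass_flow N \<omega> t x = dens N \<omega> t x * vel N \<omega> t x"

definition pressure :: "'a gas_network \<Rightarrow> 'a \<times> 'a \<Rightarrow> real \<Rightarrow> real \<Rightarrow> real" where
  "pressure N \<omega> t x = gas_const N * temp N \<omega> t x * dens N \<omega> t x"

definition internal_energy :: "'a gas_network \<Rightarrow> 'a \<times> 'a \<Rightarrow> real \<Rightarrow> real \<Rightarrow> real" where
  "internal_energy N \<omega> t x = c_v N * temp N \<omega> t x"

definition total_energy :: "'a gas_network \<Rightarrow> 'a \<times> 'a \<Rightarrow> real \<Rightarrow> real \<Rightarrow> real" where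
  "total_energy N \<omega> t x = dens N \<omega> t x * (internal_energy N \<omega> t x + (vel N \<omega> t x)\<^sup>2 / 2)"

definition enthalpy :: "'a gas_network \<Rightarrow> 'a \<times> 'a \<Rightarrow> real \<Rightarrow> real \<Rightarrow> real" where
  "enthalpy N \<omega> t x = (total_energy N \<omega> t x + pressure N \<omega> t x) / dens N \<omega> t x"

definition entropy :: "'a gas_network \<Rightarrow> 'a \<times> 'a \<Rightarrow> real \<Rightarrow> real \<Rightarrow> real" where
  "entropy N \<omega> t x = c_v N * ln (pressure N \<omega> t x / dens N \<omega> t x powr adiabatic_index N)"

text \<open>
  Smoothness is joint continuous differentiability for positive times, up to both pipe ends.
\<close>

definition C1_on :: "(real \<times> real) set \<Rightarrow> (real \<Rightarrow> real \<Rightarrow> real) \<Rightarrow> bool" where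
  "C1_on S f \<longleftrightarrow> (\<exists>ft fx. continuous_on S ft \<and> continuous_on S fx \<and>
     (\<forall>z\<in>S. ((\<lambda>(t, x). f t x) has_derivative (\<lambda>(a, b). ft z * a + fx z * b)) (at z within S)))"

definition smooth_flow :: "'a gas_network \<Rightarrow> bool" where
  "smooth_flow N \<longleftrightarrow> (\<forall>\<omega>\<in>parcs (dgraph N). \<forall>f\<in>{dens N, vel N, temp N}.
     C1_on ({0<..} \<times> {0..len N \<omega>}) (f \<omega>))"

definition delta_in :: "'a gas_network \<Rightarrow> 'a \<Rightarrow> ('a \<times> 'a) set" where
  "delta_in N \<nu> = in_arcs (with_proj (dgraph N)) \<nu>"

definition delta_out :: "'a gas_network \<Rightarrow> 'a \<Rightarrow> ('a \<times> 'a) set" where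
  "delta_out N \<nu> = out_arcs (with_proj (dgraph N)) \<nu>"

definition adj_pipes :: "'a gas_network \<Rightarrow> 'a \<Rightarrow> ('a \<times> 'a) set" where
  "adj_pipes N \<nu> = delta_out N \<nu> \<union> delta_in N \<nu>"

definition incidence :: "'a \<times> 'a \<Rightarrow> 'a \<Rightarrow> real" where
  "incidence \<omega> \<nu> = (if fst \<omega> = \<nu> then 1 else if snd \<omega> = \<nu> then - 1 else 0)"

text \<open>
  The evaluation \<open>f\<^sup>\<omega>|\<^sub>\<nu>\<close> at the end of \<open>\<omega>\<close> located at \<open>\<nu>\<close>, meaningful for pipes adjacent to \<open>\<nu>\<close>.
\<close>

definition at_node ::
    "'a gas_network \<Rightarrow> 'a \<Rightarrow> ('a \<times> 'a \<Rightarrow> real \<Rightarrow> real \<Rightarrow> real) \<Rightarrow> 'a \<times> 'a \<Rightarrow> real \<Rightarrow> real" where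
  "at_node N \<nu> f \<omega> t = f \<omega> t (if fst \<omega> = \<nu> then 0 else len N \<omega>)"

definition I_in :: "'a gas_network \<Rightarrow> 'a \<Rightarrow> real \<Rightarrow> ('a \<times> 'a) set" where
  "I_in N \<nu> t = {\<omega>\<in>delta_in N \<nu>. at_node N \<nu> (mass_flow N) \<omega> t \<ge> 0} \<union>
                {\<omega>\<in>delta_out N \<nu>. at_node N \<nu> (mass_flow N) \<omega> t \<le> 0}"

definition I_out :: "'a gas_network \<Rightarrow> 'a \<Rightarrow> real \<Rightarrow> ('a \<times> 'a) set" where
  "I_out N \<nu> t = {\<omega>\<in>delta_in N \<nu>. at_node N \<nu> (mass_flow N) \<omega> t < 0} \<union>
                 {\<omega>\<in>delta_out N \<nu>. at_node N \<nu> (mass_flow N) \<omega> t > 0}"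

definition fixed_flow_direction :: "'a gas_network \<Rightarrow> 'a \<Rightarrow> bool" where
  "fixed_flow_direction N \<nu> \<longleftrightarrow>
     (\<forall>t>0. I_in N \<nu> t = delta_in N \<nu> \<and> I_out N \<nu> t = delta_out N \<nu>)"

definition mass_conservation :: "'a gas_network \<Rightarrow> 'a \<Rightarrow> real \<Rightarrow> bool" where
  "mass_conservation N \<nu> t \<longleftrightarrow>
     (\<Sum>\<omega>\<in>adj_pipes N \<nu>. incidence \<omega> \<nu> * at_node N \<nu> (mass_flow N) \<omega> t) = 0"

definition equal_enthalpy :: "'a gas_network \<Rightarrow> 'a \<Rightarrow> real \<Rightarrow> bool" where
  "equal_enthalpy N \<nu> t \<longleftrightarrow>
     (\<exists>h. \<forall>\<omega>\<in>adj_pipes N \<nu>. at_node N \<nu> (enthalpy N) \<omega> t = h)"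

definition inflow :: "'a gas_network \<Rightarrow> 'a \<Rightarrow> real \<Rightarrow> real" where
  "inflow N \<nu> t = (\<Sum>\<omega>\<in>I_in N \<nu> t. incidence \<omega> \<nu> * at_node N \<nu> (mass_flow N) \<omega> t)"

definition mixed_entropy :: "'a gas_network \<Rightarrow> 'a \<Rightarrow> real \<Rightarrow> real" where
  "mixed_entropy N \<nu> t = 1 / inflow N \<nu> t *
     (\<Sum>\<omega>\<in>I_in N \<nu> t. incidence \<omega> \<nu> * at_node N \<nu> (mass_flow N) \<omega> t * at_node N \<nu> (entropy N) \<omega> t)"

definition equal_outgoing_entropy :: "'a gas_network \<Rightarrow> 'a \<Rightarrow> real \<Rightarrow> bool" where
  "equal_outgoing_entropy N \<nu> t \<longleftrightarrow>
     (\<forall>\<omega>\<in>I_out N \<nu> t. at_node N \<nu> (entropy N) \<omega> t = mixed_entropy N \<nu> t)"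

end

theory Submission
  imports Defs
begin

text \<open>
  The energy flux through the end of a pipe is the mass flow times the enthalpy, so a common
  enthalpy factors out of the energy balance and leaves the mass balance. For the entropy, the
  incoming terms sum to \<open>s\<^sup>*\<close> times the inflow by the choice of \<open>s\<^sup>*\<close>, the outgoing ones to \<open>s\<^sup>*\<close>
  times the outflow, and the two cancel by the mass balance.
\<close>

text \<open>The entropy balance stripped of the network: \<open>w\<close> stands for the signed mass
  flow, \<open>s\<close> for the entropy, \<open>A\<close> for the incoming and \<open>B\<close> for
  the outgoing pipes.\<close>

lemma weighted_mean_balance:
  fixes w s :: "'b \<Rightarrow> real"
  assumes "finite A" "finite B" "A \<inter> B = {}"
    and nz: "sum w A \<noteq> 0"
    and mean: "\<And>x. x \<in> B \<Longrightarrow> s x = 1 / sum w A * (\<Sum>y\<in>A. w y * s y)"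
    and balance: "sum w (A \<union> B) = 0"
  shows "(\<Sum>x\<in>A \<union> B. w x * s x) = 0"
proof -
  define m where "m = 1 / sum w A * (\<Sum>y\<in>A. w y * s y)"
  have "(\<Sum>x\<in>B. w x * s x) = sum w B * m"
    unfolding sum_distrib_right by (intro sum.cong refl) (simp only: mean m_def)
  \<comment> \<open>Here \<open>nz\<close> is essential: with total weight 0, HOL division would
    make \<open>m\<close> equal to 0, whatever the sum over \<open>A\<close> is.\<close>
  moreover have "(\<Sum>x\<in>A. w x * s x) = sum w A * m"
    using nz by (simp add: m_def)
  ultimately have "(\<Sum>x\<in>A \<union> B. w x * s x) = (sum w A + sum w B) * m"
    using assms(1-3) by (simp add: sum.union_disjoint distrib_right)
  then show ?thesis
    using assms(1-3) balance by (simp add: sum.union_disjoint)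
qed

text \<open>These facts allow a sum over all pipes at \<nu> to be split by direction. A pipe in both
  sets would be a self-loop at \<nu>.\<close>

lemma
  assumes "gas_network N"
  shows finite_delta_in: "finite (delta_in N \<nu>)"
    and finite_delta_out: "finite (delta_out N \<nu>)"
    and delta_in_out_disjoint: "delta_in N \<nu> \<inter> delta_out N \<nu> = {}"
proof -
  interpret pair_digraph "dgraph N"
    using assms by (simp add: gas_network_def)
  show "finite (delta_in N \<nu>)" "finite (delta_out N \<nu>)"
    by (simp_all add: delta_in_def delta_out_def in_arcs_def out_arcs_def)
  show "delta_in N \<nu> \<inter> delta_out N \<nu> = {}"
    using no_loops by (fastforce simp: delta_in_def delta_out_def)
qed

text \<open>Both positions 0 and \<open>len N \<omega>\<close> lie in the interval on which the
  density is assumed positive, because the length is positive.\<close>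

lemma at_node_dens_pos:
  assumes "gas_network N" "\<omega> \<in> adj_pipes N \<nu>" "t > 0"
  shows "at_node N \<nu> (dens N) \<omega> t > 0"
proof -
  have "\<omega> \<in> parcs (dgraph N)"
    using assms(2) by (auto simp: adj_pipes_def delta_in_def delta_out_def)
  then have "len N \<omega> > 0" "\<forall>x\<in>{0..len N \<omega>}. dens N \<omega> t x > 0"
    using assms(1,3) by (auto simp: gas_network_def)
  then show ?thesis
    by (simp add: at_node_def)
qed

text \<open>The density factor of \<open>mass_flow\<close> cancels the denominator of
  \<open>enthalpy\<close>.\<close>

lemma energy_flux_eq_mass_flow_enthalpy:
  assumes "at_node N \<nu> (dens N) \<omega> t \<noteq> 0"
  shows "at_node N \<nu> (\<lambda>\<omega> t x. vel N \<omega> t x * (total_energy N \<omega> t x + pressure N \<omega> t x)) \<omega> t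
       = at_node N \<nu> (mass_flow N) \<omega> t * at_node N \<nu> (enthalpy N) \<omega> t"
  using assms by (simp add: at_node_def mass_flow_def enthalpy_def)

lemma energy_conservation_at_node:
  assumes "gas_network N" "t > 0" "mass_conservation N \<nu> t" "equal_enthalpy N \<nu> t"
  shows "(\<Sum>\<omega>\<in>adj_pipes N \<nu>. incidence \<omega> \<nu> *
           at_node N \<nu> (\<lambda>\<omega> t x. vel N \<omega> t x * (total_energy N \<omega> t x + pressure N \<omega> t x)) \<omega> t) = 0"
    (is "(\<Sum>\<omega>\<in>_. _ * ?flux \<omega>) = 0")
proof -
  obtain h where h: "\<And>\<omega>. \<omega> \<in> adj_pipes N \<nu> \<Longrightarrow> at_node N \<nu> (enthalpy N) \<omega> t = h"
    using assms(4) by (auto simp: equal_enthalpy_def)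
  have flux: "?flux \<omega> = at_node N \<nu> (mass_flow N) \<omega> t * h" if "\<omega> \<in> adj_pipes N \<nu>" for \<omega>
    using at_node_dens_pos[OF assms(1) that assms(2)]
    by (simp only: energy_flux_eq_mass_flow_enthalpy h[OF that] less_imp_neq[symmetric] not_False_eq_True)
  have "(\<Sum>\<omega>\<in>adj_pipes N \<nu>. incidence \<omega> \<nu> * ?flux \<omega>)
      = (\<Sum>\<omega>\<in>adj_pipes N \<nu>. incidence \<omega> \<nu> * at_node N \<nu> (mass_flow N) \<omega> t) * h"
    unfolding sum_distrib_right by (intro sum.cong refl) (simp only: flux mult.assoc)
  then show ?thesis
    using assms(3) by (simp add: mass_conservation_def)
qed

lemma entropy_conservation_at_node:
  assumes "gas_network N" "fixed_flow_direction N \<nu>" "t > 0"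
    and "mass_conservation N \<nu> t" "inflow N \<nu> t \<noteq> 0" "equal_outgoing_entropy N \<nu> t"
  shows "(\<Sum>\<omega>\<in>adj_pipes N \<nu>. incidence \<omega> \<nu> *
           at_node N \<nu> (mass_flow N) \<omega> t * at_node N \<nu> (entropy N) \<omega> t) = 0"
proof -
  \<comment> \<open>This turns the sums in \<open>inflow\<close> and \<open>mixed_entropy\<close>,
    taken over sets that depend on time, into sums over the pipes ending at \<nu>.\<close>
  have dir: "I_in N \<nu> t = delta_in N \<nu>" "I_out N \<nu> t = delta_out N \<nu>"
    using assms(2,3) by (auto simp: fixed_flow_direction_def)
  have adj: "adj_pipes N \<nu> = delta_in N \<nu> \<union> delta_out N \<nu>"
    by (auto simp: adj_pipes_def)
  show ?thesis
    unfolding adj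
  \<comment> \<open>The weight is incidence times mass flow; the requirement of nonzero total weight
    becomes that of nonzero inflow.\<close>
  proof (rule weighted_mean_balance)
    show "finite (delta_in N \<nu>)" "finite (delta_out N \<nu>)" "delta_in N \<nu> \<inter> delta_out N \<nu> = {}"
      by (fact finite_delta_in[OF assms(1)] finite_delta_out[OF assms(1)]
          delta_in_out_disjoint[OF assms(1)])+
    show "(\<Sum>\<omega>\<in>delta_in N \<nu>. incidence \<omega> \<nu> * at_node N \<nu> (mass_flow N) \<omega> t) \<noteq> 0"
      using assms(5) unfolding inflow_def dir .
    show "(\<Sum>\<omega>\<in>delta_in N \<nu> \<union> delta_out N \<nu>. incidence \<omega> \<nu> * at_node N \<nu> (mass_flow N) \<omega> t) = 0"
      using assms(4) unfolding mass_conservation_def adj .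
  \<comment> \<open>The premise \<open>mean\<close> remains; it is the outgoing entropy condition
    with \<open>mixed_entropy\<close> written out.\<close>
  qed (use assms(6) in \<open>unfold equal_outgoing_entropy_def mixed_entropy_def inflow_def dir, blast\<close>)
qed

theorem theorem16:
  fixes N :: "'a gas_network" and \<nu> :: 'a
  assumes "gas_network N"
    and "\<nu> \<in> interior_nodes N"
    and "fixed_flow_direction N \<nu>"
  shows "(\<forall>t>0. mass_conservation N \<nu> t \<and> equal_enthalpy N \<nu> t \<longrightarrow>
            (\<Sum>\<omega>\<in>adj_pipes N \<nu>. incidence \<omega> \<nu> *
               at_node N \<nu> (\<lambda>\<omega> t x. vel N \<omega> t x * (total_energy N \<omega> t x + pressure N \<omega> t x)) \<omega> t) = 0)
       \<and> (smooth_flow N \<longrightarrow>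
          (\<forall>t>0. mass_conservation N \<nu> t \<and> inflow N \<nu> t \<noteq> 0 \<and> equal_outgoing_entropy N \<nu> t \<longrightarrow>
            (\<Sum>\<omega>\<in>adj_pipes N \<nu>. incidence \<omega> \<nu> *
               at_node N \<nu> (mass_flow N) \<omega> t * at_node N \<nu> (entropy N) \<omega> t) = 0))"
  using energy_conservation_at_node[OF assms(1)] entropy_conservation_at_node[OF assms(1,3)]
  by simp

end
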